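(* Let $\Theta>1$ and let $\sigma$ be an instance of open, non-preemptive online Dial-a-Ride on the line. If $\textsc{Smartstart}_\Theta$ waits before executing its final schedule $S_N$, then $$\frac{\textsc{Smartstart}(\sigma)}{\textsc{Opt}(\sigma)}\le f_1(\Theta):=\frac{2\Theta^2+2\Theta}{\Theta^2+\Theta-2}.$$
   Context: Open, non-preemptive Dial-a-Ride on the real line. An instance is a finite nonempty set of requests $\sigma=\{\sigma_1,\dots,\sigma_n\}$ with $\sigma_i=(a_i,b_i;r_i)$, $a_i,b_i\in\mathbb{R}$, $r_i\ge 0$: request $\sigma_i$ appears at time $r_i$ at position $a_i$ and must be transported to position $b_i$. A single server of capacity $c\in\mathbb{N}\cup\{\infty\}$ (arbitrary but fixed) starts at the origin at time $0$, moves with unit speed (it may also wait), cannot pick up a request before its release time, never carries more than $c$ requests at once, and a request that was picked up stays on board until it is delivered at its destination (non-preemptive). In the open version the server need not return to the origin. The length of a schedule is the time from its start until its last request is delivered (waiting included). $L(t,p,R)$ is the length of a shortest schedule that starts at position $p$ at time $t$ and serves all requests in $R\subseteq\sigma$ respecting release times. The offline optimum is $\textsc{Opt}(\sigma):=L(0,0,\sigma)$. In the online problem, $\sigma_i$ is revealed only at time $r_i$, and the number of requests is not known in advance. Algorithm $\textsc{Smartstart}_\Theta$ (parameter $\Theta>1$): let $R_t$ be the set of requests with release time at most $t$ that have not been served by time $t$. Starting at position $p_1=0$ at time $0$, for $j=1,2,\dots$: whenever the server is idle at position $p_j$ at current time $t$, it waits until there are unserved released requests and then until the earliest time $t_j:=\min\{t'\ge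 t: R_{t'}\ne\emptyset,\ t'\ge L(t',p_j,R_{t'})/(\Theta-1)\}$. At time $t_j$ it starts a shortest schedule $S_j$ serving $\sigma_{S_j}:=R_{t_j}$ from $p_j$, and executes it while ignoring all newly appearing requests; it ends at position $p_{j+1}$, the position where the last request of $S_j$ is delivered. $N$ denotes the number of schedules needed to serve $\sigma$, and $\textsc{Smartstart}(\sigma)=t_N+L(t_N,p_N,\sigma_{S_N})$ is the time at which all requests have been served. $\textsc{Smartstart}$ waits before executing $S_N$ if $t_N$ is strictly larger than the finishing time $t_{N-1}+L(t_{N-1},p_{N-1},\sigma_{S_{N-1}})$ of $S_{N-1}$ (which is read as time $0$ if $N=1$). The inequality $A/B\le\rho$ is understood as $A\le\rho B$. *)

theory Defs
  imports "HOL-Analysis.Analysis" "HOL-Library.Extended_Nat"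
begin

section \<open>Instances\<close>

text \<open>The tag plays the role of the index \<open>i\<close> in \<open>\<sigma>\<^sub>i = (a\<^sub>i, b\<^sub>i; r\<^sub>i)\<close>; it carries no
  information for the server, but lets an instance contain several requests with the same
  source, destination and release time.\<close>

datatype request = Request (tag: nat) (src: real) (dst: real) (rel: real)

definition dar_instance :: "request set \<Rightarrow> bool" where
  "dar_instance \<sigma> \<longleftrightarrow> finite \<sigma> \<and> \<sigma> \<noteq> {} \<and> (\<forall>q\<in>\<sigma>. 0 \<le> rel q)"

section \<open>Schedules\<close>

datatype action = Pickup request | Deliver request

fun place :: "action \<Rightarrow> real" where
  "place (Pickup q) = src q"
| "place (Deliver q) = dst q"

text \<open>A schedule consists of the trajectory of the server and the list of its timed pickups and
  deliveries, in the order in which they are performed. Actions may share a time; their order in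
  the list still matters for the load, so that even a request with equal source and destination
  needs a free slot when it is picked up.\<close>

record schedule =
  traj :: "real \<Rightarrow> real"
  events :: "(real \<times> action) list"

definition actions :: "schedule \<Rightarrow> action list" where
  "actions S = map snd (events S)"

definition onboard :: "schedule \<Rightarrow> nat \<Rightarrow> request set" where
  \<comment> \<open>the requests carried after the first \<open>k\<close> actions\<close>
  "onboard S k =
     {q. Pickup q \<in> set (take k (actions S)) \<and> Deliver q \<notin> set (take k (actions S))}"

text \<open>Speed at most one is Lipschitz continuity of the trajectory with constant 1, which leaves
  room for waiting. Non-preemption is expressed by every request having exactly one pickup, at its
  source, and exactly one later delivery, at its destination.\<close>

definition valid_schedule ::
    "enat \<Rightarrow> real \<Rightarrow> real \<Rightarrow> request set \<Rightarrow> schedule \<Rightarrow> bool" where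
  "valid_schedule c t p R S \<longleftrightarrow>
     1-lipschitz_on {t..} (traj S) \<and> traj S t = p \<and>
     sorted (map fst (events S)) \<and>
     (\<forall>(s, x) \<in> set (events S). t \<le> s \<and> traj S s = place x) \<and>
     (\<forall>(s, x) \<in> set (events S). \<forall>q. x = Pickup q \<longrightarrow> rel q \<le> s) \<and>
     distinct (actions S) \<and> set (actions S) = Pickup ` R \<union> Deliver ` R \<and>
     (\<forall>k < length (actions S). \<forall>q. actions S ! k = Deliver q \<longrightarrow> q \<in> onboard S k) \<and>
     (\<forall>k \<le> length (actions S). enat (card (onboard S k)) \<le> c)"

text \<open>The last action of a valid schedule for a nonempty set of requests is a delivery.\<close>

definition sched_length :: "real \<Rightarrow> schedule \<Rightarrow> real" where
  "sched_length t S = (if events S = [] then 0 else fst (last (events S)) - t)"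

definition shortest_schedule ::
    "enat \<Rightarrow> real \<Rightarrow> real \<Rightarrow> request set \<Rightarrow> schedule \<Rightarrow> bool" where
  "shortest_schedule c t p R S \<longleftrightarrow>
     valid_schedule c t p R S \<and>
     (\<forall>S'. valid_schedule c t p R S' \<longrightarrow> sched_length t S \<le> sched_length t S')"

text \<open>For finite \<open>R\<close> and \<open>c \<ge> 1\<close> the infimum is a minimum: there are finitely many orders of the
  actions, and for each of them performing every action as early as possible is optimal.\<close>

definition L :: "enat \<Rightarrow> real \<Rightarrow> real \<Rightarrow> request set \<Rightarrow> real" where
  "L c t p R = Inf {sched_length t S | S. valid_schedule c t p R S}"

definition Opt :: "enat \<Rightarrow> request set \<Rightarrow> real" where
  "Opt c \<sigma> = L c 0 0 \<sigma>"

section \<open>Smartstart\<close>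

text \<open>A run records \<open>N\<close> and, for \<open>j = 1, \<dots>, N\<close>, the starting time \<open>t\<^sub>j\<close>, the starting position
  \<open>p\<^sub>j\<close> and the schedule \<open>S\<^sub>j\<close>; values at other indices are irrelevant. Since shortest schedules
  are not unique, an instance may have several runs.\<close>

record run =
  num :: nat
  start :: "nat \<Rightarrow> real"
  pos :: "nat \<Rightarrow> real"
  sched :: "nat \<Rightarrow> schedule"

definition served_by :: "schedule \<Rightarrow> request set" where
  "served_by S = {q. Deliver q \<in> set (actions S)}"

definition pending :: "request set \<Rightarrow> run \<Rightarrow> nat \<Rightarrow> real \<Rightarrow> request set" where
  \<comment> \<open>\<open>R\<^sub>\<tau>\<close> for times \<open>\<tau>\<close> between the end of \<open>S\<^sub>j\<^sub>-\<^sub>1\<close> and the start of \<open>S\<^sub>j\<close>\<close>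
  "pending \<sigma> A j \<tau> = {q \<in> \<sigma>. rel q \<le> \<tau>} - (\<Union>i\<in>{1..<j}. served_by (sched A i))"

definition batch :: "request set \<Rightarrow> run \<Rightarrow> nat \<Rightarrow> request set" where
  \<comment> \<open>the set of requests that \<open>S\<^sub>j\<close> serves\<close>
  "batch \<sigma> A j = pending \<sigma> A j (start A j)"

definition finish :: "enat \<Rightarrow> request set \<Rightarrow> run \<Rightarrow> nat \<Rightarrow> real" where
  \<comment> \<open>finishing time of \<open>S\<^sub>j\<close>; for \<open>j = 0\<close> the time at which the server becomes available\<close>
  "finish c \<sigma> A j =
     (if j = 0 then 0 else start A j + L c (start A j) (pos A j) (batch \<sigma> A j))"

definition start_times :: "enat \<Rightarrow> real \<Rightarrow> request set \<Rightarrow> run \<Rightarrow> nat \<Rightarrow> real set" where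
  "start_times c \<Theta> \<sigma> A j =
     {\<tau>. finish c \<sigma> A (j - 1) \<le> \<tau> \<and> pending \<sigma> A j \<tau> \<noteq> {} \<and>
         L c \<tau> (pos A j) (pending \<sigma> A j \<tau>) / (\<Theta> - 1) \<le> \<tau>}"

definition smartstart_run :: "enat \<Rightarrow> real \<Rightarrow> request set \<Rightarrow> run \<Rightarrow> bool" where
  "smartstart_run c \<Theta> \<sigma> A \<longleftrightarrow>
     pos A 1 = 0 \<and>
     (\<forall>j\<in>{1..num A}.
        start A j \<in> start_times c \<Theta> \<sigma> A j \<and>
        (\<forall>\<tau>\<in>start_times c \<Theta> \<sigma> A j. start A j \<le> \<tau>) \<and>
        shortest_schedule c (start A j) (pos A j) (batch \<sigma> A j) (sched A j)) \<and>
     (\<forall>j\<in>{1..<num A}. pos A (Suc j) = place (last (actions (sched A j)))) \<and>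
     (\<Union>j\<in>{1..num A}. served_by (sched A j)) = \<sigma>"

definition smartstart_cost :: "enat \<Rightarrow> request set \<Rightarrow> run \<Rightarrow> real" where
  "smartstart_cost c \<sigma> A =
     start A (num A) + L c (start A (num A)) (pos A (num A)) (batch \<sigma> A (num A))"

definition waits_before_final :: "enat \<Rightarrow> request set \<Rightarrow> run \<Rightarrow> bool" where
  "waits_before_final c \<sigma> A \<longleftrightarrow> finish c \<sigma> A (num A - 1) < start A (num A)"

definition f1 :: "real \<Rightarrow> real" where
  "f1 \<Theta> = (2 * \<Theta>\<^sup>2 + 2 * \<Theta>) / (\<Theta>\<^sup>2 + \<Theta> - 2)"

end

theory Submission imports Defs begin

text \<open>Let \<open>l\<close> be the length of an offline schedule \<open>S\<close>, and let \<open>s\<close> and \<open>a\<close> be the time and place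
  at which \<open>S\<close> picks up its first request of the final batch. A server that moves from \<open>p\<^sub>N\<close> to \<open>a\<close>
  and then imitates \<open>S\<close> shows that \<open>L\<^sub>N := L(t\<^sub>N, p\<^sub>N, R\<^sub>N) \<le> \<bar>p\<^sub>N - a\<bar> + l - s\<close>. Moreover \<open>S\<close>
  visits \<open>p\<^sub>N\<close>.

  If no request is pending just before \<open>t\<^sub>N\<close>, then the final batch is released at time \<open>t\<^sub>N\<close>, so
  \<open>t\<^sub>N \<le> s\<close> and the cost is at most \<open>l + \<bar>p\<^sub>N - a\<bar> \<le> 2 * l\<close>, because \<open>S\<close> visits both points within
  time \<open>l\<close>. Otherwise \<open>L\<close> is monotone in the set of requests and \<open>t\<^sub>N\<close> is the earliest possible
  starting time, whence \<open>t\<^sub>N \<le> L\<^sub>N / (\<Theta> - 1)\<close>; it then suffices that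
  \<open>L\<^sub>N \<le> (2 * \<Theta> + 2) / (\<Theta> + 2) * l\<close>. This follows from \<open>s \<ge> t\<^bsub>N-1\<^esub> \<ge> \<bar>p\<^sub>N\<bar> / \<Theta>\<close> and \<open>s \<ge> \<bar>a\<bar>\<close>.\<close>

section \<open>Valid schedules and the optimum \<open>L\<close>\<close>

text \<open>Lets conditions on prefixes of a restricted action list be checked on prefixes of the
  full list.\<close>

lemma filter_eq_appendD:
  assumes "filter P zs = xs @ ys"
  obtains us vs where "zs = us @ vs" "filter P us = xs" "filter P vs = ys"
  using assms
proof (induction xs arbitrary: zs thesis)
  case Nil
  show ?case using Nil.prems(1)[of "[]" zs] Nil.prems(2) by simp
next
  case (Cons x xs)
  obtain us vs where uv: "zs = us @ x # vs" "\<forall>u\<in>set us. \<not> P u" "P x" "filter P vs = xs @ ys"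
    using Cons.prems(2) filter_eq_ConsD[of P zs x "xs @ ys"] by auto
  obtain us' vs' where "vs = us' @ vs'" "filter P us' = xs" "filter P vs' = ys"
    using Cons.IH[OF _ uv(4)] by blast
  then show ?case using Cons.prems(1)[of "us @ x # us'" vs'] uv(1-3) by simp
qed

text \<open>Splits of the action list replace positions, which avoids index arithmetic when actions
  are filtered out or put in front. Distinctness ensures that a request about to be delivered has
  not been delivered before.\<close>

lemma valid_schedule_append_iff:
  "valid_schedule c t p R S \<longleftrightarrow>
     1-lipschitz_on {t..} (traj S) \<and> traj S t = p \<and>
     sorted (map fst (events S)) \<and>
     (\<forall>(s, x) \<in> set (events S). t \<le> s \<and> traj S s = place x) \<and>
     (\<forall>(s, x) \<in> set (events S). \<forall>q. x = Pickup q \<longrightarrow> rel q \<le> s) \<and>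
     distinct (actions S) \<and> set (actions S) = Pickup ` R \<union> Deliver ` R \<and>
     (\<forall>xs ys q. actions S = xs @ Deliver q # ys \<longrightarrow> Pickup q \<in> set xs) \<and>
     (\<forall>xs ys. actions S = xs @ ys \<longrightarrow>
        enat (card {q. Pickup q \<in> set xs \<and> Deliver q \<notin> set xs}) \<le> c)"
proof -
  have 1: "(\<forall>k < length (actions S). \<forall>q. actions S ! k = Deliver q \<longrightarrow> q \<in> onboard S k) \<longleftrightarrow>
     (\<forall>xs ys q. actions S = xs @ Deliver q # ys \<longrightarrow> Pickup q \<in> set xs)" (is "?A \<longleftrightarrow> ?B")
    if d: "distinct (actions S)"
  proof
    assume A: ?A
    show ?B
    proof (intro allI impI)
      fix xs ys q assume e: "actions S = xs @ Deliver q # ys"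
      then have "q \<in> onboard S (length xs)" using A by (auto simp: nth_append)
      then show "Pickup q \<in> set xs" using e by (auto simp: onboard_def)
    qed
  next
    assume B: ?B
    show ?A
    proof (intro allI impI)
      fix k q assume k: "k < length (actions S)" "actions S ! k = Deliver q"
      have e: "actions S = take k (actions S) @ Deliver q # drop (Suc k) (actions S)"
        using id_take_nth_drop[OF k(1)] k(2) by simp
      have "Deliver q \<notin> set (take k (actions S))"
        using d by (subst (asm) e) simp
      moreover have "Pickup q \<in> set (take k (actions S))"
        by (rule B[rule_format, OF e])
      ultimately show "q \<in> onboard S k" unfolding onboard_def by simp
    qed
  qed
  have 2: "(\<forall>k \<le> length (actions S). enat (card (onboard S k)) \<le> c) \<longleftrightarrow>
     (\<forall>xs ys. actions S = xs @ ys \<longrightarrow>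
        enat (card {q. Pickup q \<in> set xs \<and> Deliver q \<notin> set xs}) \<le> c)" (is "?A \<longleftrightarrow> ?B")
  proof
    assume A: ?A
    show ?B
    proof (intro allI impI)
      fix xs ys assume "actions S = xs @ ys"
      then show "enat (card {q. Pickup q \<in> set xs \<and> Deliver q \<notin> set xs}) \<le> c"
        using A[rule_format, of "length xs"] by (auto simp: onboard_def)
    qed
  next
    assume B: ?B
    show ?A
      unfolding onboard_def by (intro allI impI B[rule_format]) (rule append_take_drop_id[symmetric])
  qed
  show ?thesis
    unfolding valid_schedule_def 2 by (rule conj_cong refl 1 | assumption)+
qed

lemma
  assumes v: "valid_schedule c t p R S"
  shows valid_schedule_lipschitz: "1-lipschitz_on {t..} (traj S)"
    and valid_schedule_traj_start: "traj S t = p"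
    and valid_schedule_sorted: "sorted (map fst (events S))"
    and valid_schedule_event_ge: "(s, x) \<in> set (events S) \<Longrightarrow> t \<le> s"
    and valid_schedule_event_place: "(s, x) \<in> set (events S) \<Longrightarrow> traj S s = place x"
    and valid_schedule_pickup_released: "(s, Pickup q) \<in> set (events S) \<Longrightarrow> rel q \<le> s"
    and valid_schedule_distinct: "distinct (actions S)"
    and valid_schedule_actions: "set (actions S) = Pickup ` R \<union> Deliver ` R"
    and valid_schedule_pickup_before:
      "actions S = xs @ Deliver q # ys \<Longrightarrow> Pickup q \<in> set xs"
    and valid_schedule_capacity:
      "actions S = xs @ ys \<Longrightarrow> enat (card {q. Pickup q \<in> set xs \<and> Deliver q \<notin> set xs}) \<le> c"
proof -
  note V = v[unfolded valid_schedule_append_iff]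
  show "1-lipschitz_on {t..} (traj S)" using V by (elim conjE)
  show "traj S t = p" using V by (elim conjE)
  show "sorted (map fst (events S))" using V by (elim conjE)
  have ge: "\<forall>(s, x) \<in> set (events S). t \<le> s \<and> traj S s = place x" using V by (elim conjE)
  then show "(s, x) \<in> set (events S) \<Longrightarrow> t \<le> s" by blast
  show "(s, x) \<in> set (events S) \<Longrightarrow> traj S s = place x" using ge by blast
  have "\<forall>(s, x) \<in> set (events S). \<forall>q. x = Pickup q \<longrightarrow> rel q \<le> s" using V by (elim conjE)
  then show "(s, Pickup q) \<in> set (events S) \<Longrightarrow> rel q \<le> s" by blast
  show "distinct (actions S)" using V by (elim conjE)
  show "set (actions S) = Pickup ` R \<union> Deliver ` R" using V by (elim conjE)
  have "\<forall>xs ys q. actions S = xs @ Deliver q # ys \<longrightarrow> Pickup q \<in> set xs" using V by (elim conjE)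
  then show "actions S = xs @ Deliver q # ys \<Longrightarrow> Pickup q \<in> set xs" by (elim allE impE)
  have "\<forall>xs ys. actions S = xs @ ys \<longrightarrow>
      enat (card {q. Pickup q \<in> set xs \<and> Deliver q \<notin> set xs}) \<le> c" using V by (elim conjE)
  then show "actions S = xs @ ys \<Longrightarrow> enat (card {q. Pickup q \<in> set xs \<and> Deliver q \<notin> set xs}) \<le> c"
    by (elim allE impE)
qed

lemma valid_scheduleI:
  assumes "1-lipschitz_on {t..} (traj S)" "traj S t = p" "sorted (map fst (events S))"
    and "\<And>s x. (s, x) \<in> set (events S) \<Longrightarrow> t \<le> s"
    and "\<And>s x. (s, x) \<in> set (events S) \<Longrightarrow> traj S s = place x"
    and "\<And>s q. (s, Pickup q) \<in> set (events S) \<Longrightarrow> rel q \<le> s"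
    and "distinct (actions S)" "set (actions S) = Pickup ` R \<union> Deliver ` R"
    and "\<And>xs ys q. actions S = xs @ Deliver q # ys \<Longrightarrow> Pickup q \<in> set xs"
    and "\<And>xs ys. actions S = xs @ ys \<Longrightarrow>
        enat (card {q. Pickup q \<in> set xs \<and> Deliver q \<notin> set xs}) \<le> c"
  shows "valid_schedule c t p R S"
proof -
  have "\<forall>(s, x) \<in> set (events S). t \<le> s \<and> traj S s = place x"
    using assms(4,5) by blast
  moreover have "\<forall>(s, x) \<in> set (events S). \<forall>q. x = Pickup q \<longrightarrow> rel q \<le> s"
    using assms(6) by blast
  ultimately show ?thesis
    unfolding valid_schedule_append_iff using assms(1-3,7-10) by (intro conjI allI impI)
qed

lemma valid_schedule_traj_dist:
  assumes "valid_schedule c t p R S" "t \<le> x" "t \<le> y"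
  shows "\<bar>traj S x - traj S y\<bar> \<le> \<bar>x - y\<bar>"
  using lipschitz_onD[OF valid_schedule_lipschitz[OF assms(1)], of x y] assms(2,3)
  by (simp add: dist_real_def)

lemma valid_schedule_event_le:
  assumes "valid_schedule c t p R S" "(s, x) \<in> set (events S)"
  shows "s \<le> t + sched_length t S"
proof -
  have "events S \<noteq> []" using assms(2) by auto
  then obtain es e where es: "events S = es @ [e]" by (metis rev_exhaust)
  then have "s \<le> fst e"
    using assms(2) valid_schedule_sorted[OF assms(1)] by (force simp: sorted_append)
  then show ?thesis by (simp add: sched_length_def es)
qed

lemma sched_length_nonneg:
  assumes "valid_schedule c t p R S"
  shows "0 \<le> sched_length t S"
proof (cases "events S = []")
  case False
  then have "(fst (last (events S)), snd (last (events S))) \<in> set (events S)" by simp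
  then show ?thesis using valid_schedule_event_ge[OF assms] False
    by (fastforce simp: sched_length_def)
qed (simp add: sched_length_def)

lemma L_le:
  assumes "valid_schedule c t p R S"
  shows "L c t p R \<le> sched_length t S"
  unfolding L_def
proof (rule cInf_lower)
  show "bdd_below {sched_length t S | S. valid_schedule c t p R S}"
    by (rule bdd_belowI[of _ 0]) (use sched_length_nonneg in auto)
qed (use assms in auto)

text \<open>The infimum is attained at a shortest schedule, and a run supplies such
  schedules.\<close>

lemma L_eq_shortest:
  assumes "shortest_schedule c t p R S"
  shows "L c t p R = sched_length t S"
  unfolding L_def
  by (rule cInf_eq_minimum) (use assms in \<open>auto simp: shortest_schedule_def\<close>)

section \<open>Restricting, translating and extending schedules\<close>

text \<open>The server keeps its trajectory and skips the other requests. Loads cannot grow, because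
  a request on board after a filtered prefix is on board after the corresponding prefix of
  \<open>S\<close>.\<close>

lemma valid_schedule_restrict:
  assumes v: "valid_schedule c t p R S" and R': "R' \<subseteq> R"
  defines "S' \<equiv> S\<lparr>events := filter (\<lambda>e. snd e \<in> Pickup ` R' \<union> Deliver ` R') (events S)\<rparr>"
  shows "valid_schedule c t p R' S'"
proof -
  let ?P = "\<lambda>x. x \<in> Pickup ` R' \<union> Deliver ` R'"
  have tr: "traj S' = traj S" by (simp add: S'_def)
  have sub: "set (events S') \<subseteq> set (events S)" by (auto simp: S'_def)
  have act: "actions S' = filter ?P (actions S)"
    by (simp add: S'_def actions_def filter_map o_def)
  have "Pickup q \<in> set xs" if e: "actions S' = xs @ Deliver q # ys" for xs ys q
  proof -
    obtain us vs where us: "actions S = us @ vs" "filter ?P us = xs" "filter ?P vs = Deliver q # ys"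
      using e unfolding act by (rule filter_eq_appendD)
    then obtain vs1 vs2 where "vs = vs1 @ Deliver q # vs2" and n: "\<forall>u\<in>set vs1. \<not> ?P u"
        and q: "?P (Deliver q)"
      unfolding filter_eq_Cons_iff by blast
    then have "actions S = (us @ vs1) @ Deliver q # vs2" using us by simp
    then have "Pickup q \<in> set (us @ vs1)" by (rule valid_schedule_pickup_before[OF v])
    moreover have "?P (Pickup q)" using q by auto
    \<comment> \<open>All actions in \<open>vs1\<close> are filtered out, so the pickup of the kept
      request \<open>q\<close> is not among them.\<close>
    ultimately have "Pickup q \<in> set us" using n by auto
    then show ?thesis using us(2) \<open>?P (Pickup q)\<close> by auto
  qed
  moreover have "enat (card {q. Pickup q \<in> set xs \<and> Deliver q \<notin> set xs}) \<le> c"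
    if e: "actions S' = xs @ ys" for xs ys
  proof -
    obtain us vs where us: "actions S = us @ vs" "filter ?P us = xs"
      using e unfolding act by (rule filter_eq_appendD)
    have "finite {q. Pickup q \<in> set us}"
      by (rule finite_subset[OF _ finite_vimageI[of "set us" Pickup]]) (auto simp: inj_def)
    then have "card {q. Pickup q \<in> set xs \<and> Deliver q \<notin> set xs}
        \<le> card {q. Pickup q \<in> set us \<and> Deliver q \<notin> set us}"
      by (intro card_mono) (use us(2) in auto)
    moreover have "enat (card {q. Pickup q \<in> set us \<and> Deliver q \<notin> set us}) \<le> c"
      by (rule valid_schedule_capacity[OF v us(1)])
    ultimately show ?thesis by (meson enat_ord_simps(1) order_trans)
  qed
  moreover have "sorted (map fst (events S'))"
    using sorted_filter[OF valid_schedule_sorted[OF v]] by (simp add: S'_def)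
  moreover have "distinct (actions S')"
    using valid_schedule_distinct[OF v] by (simp add: act)
  moreover have "set (actions S') = Pickup ` R' \<union> Deliver ` R'"
    using valid_schedule_actions[OF v] R' by (auto simp: act)
  ultimately show ?thesis
    using sub valid_schedule_lipschitz[OF v] valid_schedule_traj_start[OF v]
      valid_schedule_event_ge[OF v] valid_schedule_event_place[OF v]
      valid_schedule_pickup_released[OF v]
    by (intro valid_scheduleI) (auto simp: tr)
qed

lemma sched_length_restrict:
  assumes v: "valid_schedule c t p R S"
  shows "sched_length t (S\<lparr>events := filter P (events S)\<rparr>) \<le> sched_length t S"
proof (cases "filter P (events S) = []")
  case True
  then show ?thesis using sched_length_nonneg[OF v] by (simp add: sched_length_def)
next
  case False
  then have "last (filter P (events S)) \<in> set (filter P (events S))" by (rule last_in_set)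
  then have "last (filter P (events S)) \<in> set (events S)" by simp
  then have "fst (last (filter P (events S))) \<le> t + sched_length t S"
    using valid_schedule_event_le[OF v] by (metis prod.collapse)
  then show ?thesis using False by (simp add: sched_length_def)
qed

text \<open>Since all requests are released by \<open>t'\<close>, a translation in time, in either
  direction, cannot violate a release time.\<close>

lemma valid_schedule_shift:
  assumes v: "valid_schedule c t p R S" and r: "\<forall>q\<in>R. rel q \<le> t'"
  defines "S' \<equiv> \<lparr>traj = (\<lambda>x. traj S (x - t' + t)),
                 events = map (\<lambda>(s, x). (s - t + t', x)) (events S)\<rparr>"
  shows "valid_schedule c t' p R S'" and "sched_length t' S' = sched_length t S"
proof -
  have act: "actions S' = actions S"
    by (auto simp: actions_def S'_def)
  have ev: "(s - t' + t, x) \<in> set (events S)" if "(s, x) \<in> set (events S')" for s x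
    using that by (auto simp: S'_def)
  show "valid_schedule c t' p R S'"
  proof (rule valid_scheduleI)
    show "1-lipschitz_on {t'..} (traj S')"
    proof (rule lipschitz_onI)
      fix x y assume "x \<in> {t'..}" "y \<in> {t'..}"
      then show "dist (traj S' x) (traj S' y) \<le> 1 * dist x y"
        using valid_schedule_traj_dist[OF v, of "x - t' + t" "y - t' + t"]
        by (simp add: S'_def dist_real_def)
    qed simp
    show "traj S' t' = p" using valid_schedule_traj_start[OF v] by (simp add: S'_def)
    have "map fst (events S') = map (\<lambda>s. s - t + t') (map fst (events S))"
      by (auto simp: S'_def)
    then show "sorted (map fst (events S'))"
      using valid_schedule_sorted[OF v] by (simp add: sorted_map)
    show "t' \<le> s" if "(s, x) \<in> set (events S')" for s x
      using valid_schedule_event_ge[OF v ev[OF that]] by simp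
    show "rel q \<le> s" if "(s, Pickup q) \<in> set (events S')" for s q
    proof -
      have "Pickup q \<in> set (actions S)" using ev[OF that] by (force simp: actions_def)
      then have "q \<in> R" using valid_schedule_actions[OF v] by auto
      then show ?thesis using r valid_schedule_event_ge[OF v ev[OF that]] by force
    qed
    show "traj S' s = place x" if "(s, x) \<in> set (events S')" for s x
      using valid_schedule_event_place[OF v ev[OF that]] by (simp add: S'_def)
  qed (unfold act, (rule valid_schedule_distinct[OF v] valid_schedule_actions[OF v]
        | erule valid_schedule_pickup_before[OF v] valid_schedule_capacity[OF v])+)
  show "sched_length t' S' = sched_length t S"
    by (auto simp: sched_length_def S'_def last_map split_beta)
qed

text \<open>An optimal schedule for \<open>R\<close> is restricted to \<open>R'\<close> and
  translated to start at \<open>t'\<close>, which may lie before \<open>t\<close>.\<close>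

lemma L_mono:
  assumes S: "valid_schedule c t p R S" "L c t p R = sched_length t S"
    and R': "R' \<subseteq> R" and r: "\<forall>q\<in>R'. rel q \<le> t'"
  shows "L c t' p R' \<le> L c t p R"
proof -
  note S' = valid_schedule_restrict[OF S(1) R']
  show ?thesis
    using order_trans[OF order_trans[OF L_le[OF valid_schedule_shift(1)[OF S' r]]
        eq_refl[OF valid_schedule_shift(2)[OF S' r]]] sched_length_restrict[OF S(1)]]
    unfolding S(2) .
qed

lemma valid_schedule_later_start:
  assumes v: "valid_schedule c t p R S" and "t \<le> s"
    and s: "\<forall>e\<in>set (events S). s \<le> fst e"
  shows "valid_schedule c s (traj S s) R S"
proof -
  have "1-lipschitz_on {s..} (traj S)"
    using valid_schedule_lipschitz[OF v] by (rule lipschitz_on_subset) (use \<open>t \<le> s\<close> in auto)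
  then show ?thesis
    by (rule valid_scheduleI)
      (use s valid_schedule_sorted[OF v] valid_schedule_event_place[OF v]
        valid_schedule_pickup_released[OF v] valid_schedule_distinct[OF v]
        valid_schedule_actions[OF v] valid_schedule_pickup_before[OF v]
        valid_schedule_capacity[OF v] in \<open>(simp; fail | fastforce; fail | blast)\<close>)+
qed

text \<open>The server moves with constant velocity from \<open>p\<close> to \<open>g t'\<close> and
  follows \<open>g\<close> from time \<open>t'\<close> on.\<close>

lemma lipschitz_prepend_move:
  fixes g :: "real \<Rightarrow> real"
  assumes g: "1-lipschitz_on {t'..} g" and d: "\<bar>g t' - p\<bar> \<le> t' - t"
  obtains f where "1-lipschitz_on {t..} f" "f t = p" "\<And>x. t' \<le> x \<Longrightarrow> f x = g x"
proof
  \<comment> \<open>For \<open>t' = t\<close> the quotient is 0, and the assumption forces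
    \<open>g t' = p\<close>.\<close>
  define v where "v = (g t' - p) / (t' - t)"
  define f where "f = (\<lambda>x. if x \<le> t' then p + v * (x - t) else g x)"
  have tt: "t \<le> t'" using d by linarith
  have ft': "f t' = g t'" using d by (cases "t' = t") (auto simp: f_def v_def)
  then show "f x = g x" if "t' \<le> x" for x
    using that by (cases "x = t'") (auto simp: f_def)
  note fg = this
  show "f t = p" using tt by (simp add: f_def)
  have v1: "\<bar>v\<bar> \<le> 1"
    using d by (cases "t' = t") (auto simp: v_def abs_divide)
  have le: "\<bar>f x - f y\<bar> \<le> y - x" if xy: "t \<le> x" "x \<le> y" for x y
  proof -
    have seg: "\<bar>f x - f y\<bar> \<le> y - x" if "x \<le> y" "y \<le> t'" for x y
    proof -
      have "f x - f y = v * (x - y)" using that by (simp add: f_def algebra_simps)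
      then have "\<bar>f x - f y\<bar> = \<bar>v\<bar> * (y - x)" using that by (simp add: abs_mult)
      also have "\<dots> \<le> 1 * (y - x)" using v1 that by (intro mult_right_mono) auto
      finally show ?thesis by simp
    qed
    have tail: "\<bar>f x - f y\<bar> \<le> y - x" if "t' \<le> x" "x \<le> y" for x y
      using lipschitz_onD[OF g, of x y] fg[of x] fg[of y] that by (simp add: dist_real_def)
    consider "y \<le> t'" | "t' \<le> x" | "x \<le> t'" "t' \<le> y" by linarith
    then show ?thesis
    proof cases
      case 3
      then show ?thesis using seg[of x t'] tail[of t' y] by linarith
    qed (use seg tail xy in auto)
  qed
  show "1-lipschitz_on {t..} f"
  proof (rule lipschitz_onI)
    fix x y assume "x \<in> {t..}" "y \<in> {t..}"
    then show "dist (f x) (f y) \<le> 1 * dist x y"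
      using le[of x y] le[of y x]
      by (cases "x \<le> y") (simp_all add: dist_real_def abs_minus_commute)
  qed simp
qed

lemma valid_schedule_prepend_move:
  assumes v: "valid_schedule c t' p' R S" and d: "\<bar>p' - p\<bar> \<le> t' - t"
  obtains S' where "valid_schedule c t p R S'" "events S' = events S"
proof -
  obtain f where f: "1-lipschitz_on {t..} f" "f t = p" "\<And>x. t' \<le> x \<Longrightarrow> f x = traj S x"
    using lipschitz_prepend_move[of t' "traj S" p t] valid_schedule_lipschitz[OF v]
      valid_schedule_traj_start[OF v] d by blast
  have tt: "t \<le> t'" using d by linarith
  define S' where "S' = S\<lparr>traj := f\<rparr>"
  have ev: "events S' = events S" and tr: "traj S' = f" by (auto simp: S'_def)
  have act: "actions S' = actions S" by (simp add: ev actions_def)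
  have "f s = place x" "t \<le> s" if "(s, x) \<in> set (events S)" for s x
    using valid_schedule_event_ge[OF v that] valid_schedule_event_place[OF v that] f(3) tt by auto
  then have "valid_schedule c t p R S'"
    by (intro valid_scheduleI; unfold act ev tr)
      (use f(1,2) valid_schedule_sorted[OF v]
        valid_schedule_pickup_released[OF v] valid_schedule_distinct[OF v]
        valid_schedule_actions[OF v] valid_schedule_pickup_before[OF v]
        valid_schedule_capacity[OF v] in \<open>(blast)\<close>)+
  then show thesis using that ev by blast
qed

section \<open>Existence of schedules and imitation of an offline schedule\<close>

text \<open>The server carries \<open>q\<close> alone before it follows \<open>S\<close>, so one
  free slot suffices for \<open>q\<close>.\<close>

lemma valid_schedule_insert:
  assumes v: "valid_schedule c t2 (dst q) R S" and c: "1 \<le> c" and q: "q \<notin> R"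
    and r: "rel q \<le> t1" and d1: "\<bar>src q - p\<bar> \<le> t1 - t" and d2: "\<bar>dst q - src q\<bar> \<le> t2 - t1"
  shows "\<exists>S'. valid_schedule c t p (insert q R) S'"
proof -
  have "\<bar>traj S t2 - src q\<bar> \<le> t2 - t1" using valid_schedule_traj_start[OF v] d2 by simp
  then obtain f where f: "1-lipschitz_on {t1..} f" "f t1 = src q"
      "\<And>x. t2 \<le> x \<Longrightarrow> f x = traj S x"
    by (rule lipschitz_prepend_move[OF valid_schedule_lipschitz[OF v]]) blast
  obtain g where g: "1-lipschitz_on {t..} g" "g t = p" "\<And>x. t1 \<le> x \<Longrightarrow> g x = f x"
    using lipschitz_prepend_move[OF f(1)] d1 f(2) by metis
  have tt: "t \<le> t1" "t1 \<le> t2" using d1 d2 by linarith+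
  define S' where "S' = \<lparr>traj = g, events = (t1, Pickup q) # (t2, Deliver q) # events S\<rparr>"
  have act: "actions S' = Pickup q # Deliver q # actions S" by (simp add: S'_def actions_def)
  have tr: "traj S' = g" by (simp add: S'_def)
  have gS: "g s = traj S s" if "t2 \<le> s" for s using that f(3) g(3) tt by simp
  note ge = valid_schedule_event_ge[OF v]
  have nq: "Pickup q \<notin> set (actions S)" "Deliver q \<notin> set (actions S)"
    using valid_schedule_actions[OF v] q by auto
  have "sorted (map fst (events S'))"
    using valid_schedule_sorted[OF v] ge tt by (fastforce simp: S'_def)
  moreover have "t \<le> s" "g s = place x" if "(s, x) \<in> set (events S')" for s x
    using that ge[of s x] valid_schedule_event_place[OF v, of s x] tt gS f(2) g(3)[of t1]
      f(3)[of t2] g(3)[of t2] valid_schedule_traj_start[OF v]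
    by (auto simp: S'_def)
  moreover have "rel u \<le> s" if "(s, Pickup u) \<in> set (events S')" for s u
    using that valid_schedule_pickup_released[OF v] r by (auto simp: S'_def)
  moreover have "distinct (actions S')"
    using valid_schedule_distinct[OF v] nq by (auto simp: act)
  moreover have "set (actions S') = Pickup ` insert q R \<union> Deliver ` insert q R"
    using valid_schedule_actions[OF v] by (auto simp: act)
  moreover have "Pickup r \<in> set xs" if "actions S' = xs @ Deliver r # ys" for xs ys r
    using that valid_schedule_pickup_before[OF v] by (fastforce simp: act Cons_eq_append_conv)
  moreover have "enat (card {r. Pickup r \<in> set xs \<and> Deliver r \<notin> set xs}) \<le> c"
    if e: "actions S' = xs @ ys" for xs ys
  proof -
    consider "xs = []" | "xs = [Pickup q]"
      | us where "xs = Pickup q # Deliver q # us" "actions S = us @ ys"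
      using e by (auto simp: act Cons_eq_append_conv)
    then show ?thesis
    proof cases
      case 1 then show ?thesis by (simp flip: zero_enat_def)
    next
      case 2
      then show ?thesis using c by (simp add: one_enat_def)
    next
      case 3
      then have "{r. Pickup r \<in> set xs \<and> Deliver r \<notin> set xs}
          = {r. Pickup r \<in> set us \<and> Deliver r \<notin> set us}"
        using nq by auto
      then show ?thesis using valid_schedule_capacity[OF v 3(2)] by simp
    qed
  qed
  ultimately have "valid_schedule c t p (insert q R) S'"
    using g(1,2) by (intro valid_scheduleI) (unfold tr, blast+)
  then show ?thesis ..
qed

text \<open>Requests are carried one at a time. This makes the set under the infimum in
  \<open>Opt\<close> nonempty.\<close>

lemma valid_schedule_exists:
  assumes "finite R" "1 \<le> c"
  shows "\<exists>S. valid_schedule c t p R S"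
  using assms(1)
proof (induction R arbitrary: t p rule: finite_induct)
  case empty
  have "valid_schedule c t p {} \<lparr>traj = (\<lambda>_. p), events = []\<rparr>"
    by (rule valid_scheduleI) (auto simp: actions_def lipschitz_on_def simp flip: zero_enat_def)
  then show ?case ..
next
  case (insert q R)
  \<comment> \<open>The pickup happens once the server has arrived and \<open>q\<close> is released,
    whichever is later.\<close>
  let ?t1 = "max (rel q) (t + \<bar>src q - p\<bar>)"
  let ?t2 = "?t1 + \<bar>dst q - src q\<bar>"
  obtain S where "valid_schedule c ?t2 (dst q) R S" using insert.IH by blast
  then show ?case
    by (rule valid_schedule_insert[where ?t1.0 = ?t1]) (use assms(2) insert.hyps(2) in auto)
qed

text \<open>The event at time \<open>s\<close> is the first one of \<open>S\<close> that concerns \<open>R\<close>. From there on the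
  server imitates \<open>S\<close>, omitting all other requests; releases do not matter any more.\<close>

lemma L_le_imitate:
  assumes v: "valid_schedule c t0 p0 \<sigma> S" and R: "R \<subseteq> \<sigma>" "R \<noteq> {}"
  obtains s q where "q \<in> R" "rel q \<le> s" "t0 \<le> s" "s \<le> t0 + sched_length t0 S"
    "\<And>t p. \<forall>q\<in>R. rel q \<le> t \<Longrightarrow>
       L c t p R \<le> \<bar>p - traj S s\<bar> + (t0 + sched_length t0 S - s)"
proof -
  let ?P = "\<lambda>e. snd e \<in> Pickup ` R \<union> Deliver ` R"
  define S1 where "S1 = S\<lparr>events := filter ?P (events S)\<rparr>"
  have v1: "valid_schedule c t0 p0 R S1"
    unfolding S1_def by (rule valid_schedule_restrict[OF v R(1)])
  have tr: "traj S1 = traj S" by (simp add: S1_def)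
  have len: "sched_length t0 S1 \<le> sched_length t0 S"
    unfolding S1_def by (rule sched_length_restrict[OF v])
  have "set (actions S1) \<noteq> {}" using valid_schedule_actions[OF v1] R(2) by simp
  then have "events S1 \<noteq> []" by (auto simp: actions_def)
  then obtain s x es where es: "events S1 = (s, x) # es" by (metis list.exhaust prod.exhaust)
  have mem: "(s, x) \<in> set (events S1)" by (simp add: es)
  have act: "actions S1 = [] @ x # map snd es" by (simp add: actions_def es)
  \<comment> \<open>No pickup precedes the first action, so it is itself a pickup; this bounds
    \<open>s\<close> below by a release time.\<close>
  have "x \<noteq> Deliver q" for q
  proof
    assume "x = Deliver q"
    then have "Pickup q \<in> set []"
      using valid_schedule_pickup_before[OF v1, of "[]"] act by simp
    then show False by simp
  qed
  then obtain q where x: "x = Pickup q" by (cases x) auto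
  have q: "q \<in> R" using valid_schedule_actions[OF v1] x by (auto simp: act)
  have rs: "rel q \<le> s" using valid_schedule_pickup_released[OF v1] mem x by blast
  have ts: "t0 \<le> s" using valid_schedule_event_ge[OF v1 mem] .
  have sl: "s \<le> t0 + sched_length t0 S"
    using valid_schedule_event_le[OF v1 mem] len by simp
  have ge: "\<forall>e\<in>set (events S1). s \<le> fst e"
    using valid_schedule_sorted[OF v1] by (auto simp: es)
  have v2: "valid_schedule c s (traj S s) R S1"
    using valid_schedule_later_start[OF v1 ts ge] by (simp add: tr)
  have len2: "sched_length s S1 = t0 + sched_length t0 S1 - s"
    by (simp add: sched_length_def es)
  have "L c t p R \<le> \<bar>p - traj S s\<bar> + (t0 + sched_length t0 S - s)"
    if r: "\<forall>q\<in>R. rel q \<le> t" for t p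
  proof -
    \<comment> \<open>The travel time from \<open>p\<close> to the place where the imitation begins;
      the imitation is translated to start at \<open>t + d\<close>.\<close>
    define d where "d = \<bar>p - traj S s\<bar>"
    have r': "\<forall>q\<in>R. rel q \<le> t + d" using r by (force simp: d_def)
    obtain S2 where v3: "valid_schedule c (t + d) (traj S s) R S2"
        and len3: "sched_length (t + d) S2 = sched_length s S1"
      using valid_schedule_shift[OF v2 r'] by blast
    obtain S3 where v4: "valid_schedule c t p R S3" and ev: "events S3 = events S2"
      using valid_schedule_prepend_move[OF v3, of p t] by (auto simp: d_def abs_minus_commute)
    have "L c t p R \<le> sched_length t S3" by (rule L_le[OF v4])
    also have "\<dots> \<le> d + sched_length (t + d) S2"
      by (simp add: sched_length_def ev d_def)
    also have "\<dots> \<le> d + (t0 + sched_length t0 S - s)" using len len2 len3 by simp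
    finally show ?thesis by (simp add: d_def)
  qed
  then show thesis using that q rs ts sl by blast
qed

section \<open>Times, positions and batches of a run\<close>

lemma served_by_valid_schedule:
  assumes "valid_schedule c t p R S"
  shows "served_by S = R"
  using valid_schedule_actions[OF assms] by (auto simp: served_by_def)

context
  fixes c \<Theta> \<sigma> A
  assumes \<Theta>: "\<Theta> > 1" and run: "smartstart_run c \<Theta> \<sigma> A"
begin

lemma
  assumes "1 \<le> j" "j \<le> num A"
  shows run_start: "start A j \<in> start_times c \<Theta> \<sigma> A j"
    and run_start_least: "\<tau> \<in> start_times c \<Theta> \<sigma> A j \<Longrightarrow> start A j \<le> \<tau>"
    and run_shortest: "shortest_schedule c (start A j) (pos A j) (batch \<sigma> A j) (sched A j)"
  using run assms unfolding smartstart_run_def by auto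

lemma run_valid:
  assumes "1 \<le> j" "j \<le> num A"
  shows "valid_schedule c (start A j) (pos A j) (batch \<sigma> A j) (sched A j)"
  using run_shortest[OF assms] by (simp add: shortest_schedule_def)

lemma run_L:
  assumes "1 \<le> j" "j \<le> num A"
  shows "L c (start A j) (pos A j) (batch \<sigma> A j) = sched_length (start A j) (sched A j)"
  by (rule L_eq_shortest[OF run_shortest[OF assms]])

lemma run_batch:
  assumes "1 \<le> j" "j \<le> num A"
  shows "batch \<sigma> A j \<noteq> {}" "batch \<sigma> A j \<subseteq> \<sigma>" "\<forall>q\<in>batch \<sigma> A j. rel q \<le> start A j"
  using run_start[OF assms] by (auto simp: start_times_def batch_def pending_def)

lemma run_L_le_start:
  assumes "1 \<le> j" "j \<le> num A"
  shows "L c (start A j) (pos A j) (batch \<sigma> A j) \<le> (\<Theta> - 1) * start A j"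
  using run_start[OF assms] \<Theta> by (auto simp: start_times_def batch_def field_simps)

lemma run_last_event:
  assumes "1 \<le> j" "j < num A"
  obtains s x where "(s, x) \<in> set (events (sched A j))" "pos A (Suc j) = place x"
    "s = start A j + L c (start A j) (pos A j) (batch \<sigma> A j)"
proof -
  have j: "1 \<le> j" "j \<le> num A" using assms by auto
  have "set (actions (sched A j)) \<noteq> {}"
    using valid_schedule_actions[OF run_valid[OF j]] run_batch(1)[OF j] by simp
  then have ne: "events (sched A j) \<noteq> []" by (auto simp: actions_def)
  obtain s x where sx: "last (events (sched A j)) = (s, x)" by fastforce
  have "pos A (Suc j) = place (last (actions (sched A j)))"
    using run assms unfolding smartstart_run_def by auto
  then have "pos A (Suc j) = place x" using sx ne by (simp add: actions_def last_map)
  moreover have "s = start A j + L c (start A j) (pos A j) (batch \<sigma> A j)"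
    using run_L[OF j] sx ne by (simp add: sched_length_def)
  moreover have "(s, x) \<in> set (events (sched A j))" using ne sx by (metis last_in_set)
  ultimately show thesis using that by blast
qed

lemma run_pos_step:
  assumes "1 \<le> j" "j < num A"
  shows "\<bar>pos A (Suc j) - pos A j\<bar> \<le> L c (start A j) (pos A j) (batch \<sigma> A j)"
proof -
  have j: "1 \<le> j" "j \<le> num A" using assms by auto
  obtain s x where sx: "(s, x) \<in> set (events (sched A j))" "pos A (Suc j) = place x"
    "s = start A j + L c (start A j) (pos A j) (batch \<sigma> A j)"
    using run_last_event[OF assms] .
  have "start A j \<le> s" using valid_schedule_event_ge[OF run_valid[OF j] sx(1)] .
  then show ?thesis
    using valid_schedule_traj_dist[OF run_valid[OF j], of s "start A j"]
      valid_schedule_event_place[OF run_valid[OF j] sx(1)]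
      valid_schedule_traj_start[OF run_valid[OF j]] sx(2,3) by simp
qed

text \<open>The speed is at most one in every schedule, and waiting only adds time.\<close>

lemma run_pos_le_start:
  assumes "1 \<le> j" "j \<le> num A"
  shows "\<bar>pos A j\<bar> \<le> start A j"
  using assms
proof (induction j rule: nat_induct_at_least)
  case base
  have "pos A 1 = 0" using run by (simp add: smartstart_run_def)
  then show ?case using run_start[of 1] base by (simp add: start_times_def finish_def)
next
  case (Suc j)
  then have "finish c \<sigma> A j \<le> start A (Suc j)"
    using run_start[of "Suc j"] by (simp add: start_times_def)
  then have "start A j + L c (start A j) (pos A j) (batch \<sigma> A j) \<le> start A (Suc j)"
    using Suc.hyps by (simp add: finish_def)
  then show ?case using Suc run_pos_step[of j] by fastforce
qed

text \<open>The position at the preceding start contributes at most \<open>start A j\<close>, and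
  the schedule from there moves the server by at most
  \<open>(\<Theta> - 1) * start A j\<close>.\<close>

lemma run_pos_le_prev_start:
  assumes "1 \<le> j" "j < num A"
  shows "\<bar>pos A (Suc j)\<bar> \<le> \<Theta> * start A j"
  using run_pos_step[OF assms] run_pos_le_start[of j] run_L_le_start[of j] assms
  by (simp add: algebra_simps)

text \<open>A request released by \<open>start A j\<close> and not served earlier belongs to batch
  \<open>j\<close> and is served with it.\<close>

lemma run_batch_released_after_prev_start:
  assumes "1 \<le> j" "j < num A" "q \<in> batch \<sigma> A (Suc j)"
  shows "start A j < rel q"
proof (rule ccontr)
  assume "\<not> start A j < rel q"
  moreover have "q \<in> \<sigma>" "\<forall>i\<in>{1..<Suc j}. q \<notin> served_by (sched A i)"
    using assms(3) by (auto simp: batch_def pending_def)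
  ultimately have "q \<in> batch \<sigma> A j" by (auto simp: batch_def pending_def)
  moreover have "served_by (sched A j) = batch \<sigma> A j"
    using run_valid[of j] assms by (intro served_by_valid_schedule) auto
  ultimately show False using \<open>\<forall>i\<in>{1..<Suc j}. q \<notin> served_by (sched A i)\<close> assms(1) by auto
qed

section \<open>Comparison of the final schedule with an offline schedule\<close>

text \<open>A starting position is the origin or the place of an action of the preceding schedule,
  which \<open>S\<close> has to perform too.\<close>

lemma run_pos_visited:
  assumes "1 \<le> j" "j \<le> num A" and v: "valid_schedule c 0 0 \<sigma> S"
  obtains u where "0 \<le> u" "u \<le> sched_length 0 S" "traj S u = pos A j"
proof (cases "j = 1")
  case True
  then have "traj S 0 = pos A j"
    using run valid_schedule_traj_start[OF v] by (simp add: smartstart_run_def)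
  then show thesis using that[of 0] sched_length_nonneg[OF v] by simp
next
  case False
  then obtain i where i: "j = Suc i" "1 \<le> i" "i < num A" "i \<le> num A"
    using assms by (cases j) auto
  obtain s x where sx: "(s, x) \<in> set (events (sched A i))" "pos A j = place x"
    using run_last_event[OF i(2,3)] i(1) by metis
  have "x \<in> set (actions (sched A i))" using sx(1) by (force simp: actions_def)
  then have "x \<in> set (actions S)"
    using valid_schedule_actions[OF run_valid[OF i(2,4)]] valid_schedule_actions[OF v]
      run_batch(2)[OF i(2,4)] by auto
  then obtain u where u: "(u, x) \<in> set (events S)" by (force simp: actions_def)
  show thesis
    using that[of u] valid_schedule_event_ge[OF v u] valid_schedule_event_le[OF v u]
      valid_schedule_event_place[OF v u] sx(2) by simp
qed

text \<open>Let \<open>S\<close> pick up its first request of the final batch at time \<open>s\<close> in \<open>a\<close>, and let \<open>d\<close> be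
  the distance from \<open>a\<close> to \<open>p\<^sub>N\<close>. If \<open>S\<close> visits \<open>p\<^sub>N\<close> before time \<open>s\<close>, then \<open>d \<le> s\<close>. Otherwise
  \<open>s + d\<close> is at most the length of \<open>S\<close>, while \<open>d \<le> \<bar>p\<^sub>N\<bar> + \<bar>a\<bar> \<le> (\<Theta> + 1) * s\<close>.\<close>

lemma run_L_final_le:
  assumes N: "1 \<le> num A" and v: "valid_schedule c 0 0 \<sigma> S"
  shows "(\<Theta> + 2) * L c (start A (num A)) (pos A (num A)) (batch \<sigma> A (num A))
     \<le> (2 * \<Theta> + 2) * sched_length 0 S"
proof -
  let ?N = "num A" and ?l = "sched_length 0 S"
  obtain s q where q: "q \<in> batch \<sigma> A ?N" "rel q \<le> s" and s: "0 \<le> s" "s \<le> ?l"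
    and imit: "L c (start A ?N) (pos A ?N) (batch \<sigma> A ?N) \<le> \<bar>pos A ?N - traj S s\<bar> + (?l - s)"
    using L_le_imitate[OF v run_batch(2,1)[OF N order_refl]] run_batch(3)[OF N order_refl]
    by (metis add_0)
  obtain u where u: "0 \<le> u" "u \<le> ?l" "traj S u = pos A ?N"
    using run_pos_visited[OF N order_refl v] .
  define d where "d = \<bar>pos A ?N - traj S s\<bar>"
  \<comment> \<open>The first pickup follows the release of \<open>q\<close> and hence the preceding
    start; if there is no preceding schedule, the position is the origin.\<close>
  have ps: "\<bar>pos A ?N\<bar> \<le> \<Theta> * s"
  proof (cases "num A = 1")
    case True
    then show ?thesis using run s(1) \<Theta> by (simp add: smartstart_run_def)
  next
    case False
    then obtain i where i: "num A = Suc i" "1 \<le> i" "i < num A" using N by (cases "num A") auto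
    have "start A i < rel q" using run_batch_released_after_prev_start[OF i(2,3)] q(1) i(1) by simp
    then have "start A i \<le> s" using q(2) by simp
    then have "\<Theta> * start A i \<le> \<Theta> * s" using \<Theta> by simp
    then show ?thesis using run_pos_le_prev_start[OF i(2,3)] i(1) by simp
  qed
  have "\<bar>traj S s\<bar> \<le> s"
    using valid_schedule_traj_dist[OF v, of s 0] valid_schedule_traj_start[OF v] s by simp
  then have d: "d \<le> (\<Theta> + 1) * s" using ps by (simp add: d_def algebra_simps)
  have du: "d \<le> \<bar>u - s\<bar>"
    using valid_schedule_traj_dist[OF v u(1) s(1)] u(3) by (simp add: d_def)
  \<comment> \<open>For \<open>s < u\<close>, twice \<open>d \<le> (\<Theta> + 1) * s\<close> is
    added to \<open>\<Theta> * (d + s) \<le> \<Theta> * ?l\<close>; these weights produce the factor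
    \<open>\<Theta> + 2\<close>.\<close>
  have "(\<Theta> + 2) * (d - s) \<le> \<Theta> * ?l"
  proof (cases "u \<le> s")
    case True
    then have "(\<Theta> + 2) * (d - s) \<le> 0"
      using du u(1) \<Theta> by (intro mult_nonneg_nonpos) auto
    also have "0 \<le> \<Theta> * ?l" using \<Theta> s by simp
    finally show ?thesis .
  next
    case False
    then have "\<Theta> * (d + s) \<le> \<Theta> * ?l" using du u(2) \<Theta> by (intro mult_left_mono) auto
    then show ?thesis using d by (simp add: algebra_simps)
  qed
  moreover have "(\<Theta> + 2) * L c (start A ?N) (pos A ?N) (batch \<sigma> A ?N) \<le> (\<Theta> + 2) * (d + (?l - s))"
    using imit \<Theta> by (intro mult_left_mono) (auto simp: d_def)
  ultimately show ?thesis by (simp add: algebra_simps)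
qed

text \<open>At each \<open>w\<close> strictly between \<open>\<tau>\<close> and the start some
  request is pending, so it must be the length condition that fails at \<open>w\<close>. As
  \<open>L\<close> is monotone, \<open>w\<close> is below the claimed bound; then \<open>w\<close>
  tends to the start.\<close>

lemma run_start_le_L:
  assumes j: "1 \<le> j" "j \<le> num A"
    and \<tau>: "finish c \<sigma> A (j - 1) \<le> \<tau>" "\<tau> < start A j" "pending \<sigma> A j \<tau> \<noteq> {}"
  shows "start A j \<le> L c (start A j) (pos A j) (batch \<sigma> A j) / (\<Theta> - 1)"
proof (rule dense_le_bounded[OF \<tau>(2)])
  fix w assume w: "\<tau> < w" "w < start A j"
  have "pending \<sigma> A j w \<noteq> {}" using \<tau>(3) w(1) by (fastforce simp: pending_def)
  moreover have "w \<notin> start_times c \<Theta> \<sigma> A j" using run_start_least[OF j, of w] w(2) by auto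
  ultimately have "w < L c w (pos A j) (pending \<sigma> A j w) / (\<Theta> - 1)"
    using \<tau>(1) w(1) by (auto simp: start_times_def)
  moreover have "L c w (pos A j) (pending \<sigma> A j w)
      \<le> L c (start A j) (pos A j) (batch \<sigma> A j)"
    by (rule L_mono[OF run_valid[OF j] run_L[OF j]]) (use w(2) in \<open>auto simp: batch_def pending_def\<close>)
  ultimately show "w \<le> L c (start A j) (pos A j) (batch \<sigma> A j) / (\<Theta> - 1)"
    using \<Theta> by (smt (verit) divide_right_mono)
qed

text \<open>The start is at most \<open>s\<close> and so is cancelled by the \<open>- s\<close> of
  the imitation bound. The remaining detour joins two points that \<open>S\<close> visits within its
  length.\<close>

lemma run_cost_le_fresh_batch:
  assumes N: "1 \<le> num A" and v: "valid_schedule c 0 0 \<sigma> S"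
    and fresh: "\<forall>q\<in>batch \<sigma> A (num A). start A (num A) \<le> rel q"
  shows "smartstart_cost c \<sigma> A \<le> 2 * sched_length 0 S"
proof -
  let ?N = "num A" and ?l = "sched_length 0 S"
  obtain s q where q: "q \<in> batch \<sigma> A ?N" "rel q \<le> s" and s: "0 \<le> s" "s \<le> ?l"
    and imit: "L c (start A ?N) (pos A ?N) (batch \<sigma> A ?N) \<le> \<bar>pos A ?N - traj S s\<bar> + (?l - s)"
    using L_le_imitate[OF v run_batch(2,1)[OF N order_refl]] run_batch(3)[OF N order_refl]
    by (metis add_0)
  obtain u where u: "0 \<le> u" "u \<le> ?l" "traj S u = pos A ?N"
    using run_pos_visited[OF N order_refl v] .
  have "\<bar>pos A ?N - traj S s\<bar> \<le> \<bar>u - s\<bar>"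
    using valid_schedule_traj_dist[OF v u(1) s(1)] u(3) by simp
  moreover have "start A ?N \<le> s" using fresh q by force
  ultimately show ?thesis using imit u s by (simp add: smartstart_cost_def)
qed

end

section \<open>The competitive ratio\<close>

text \<open>The factor \<open>\<Theta> / (\<Theta> - 1)\<close> accounts for waiting, and
  \<open>(2 * \<Theta> + 2) / (\<Theta> + 2)\<close> for the length of the final schedule.\<close>

lemma f1_altdef: "f1 \<Theta> = \<Theta> * (2 * \<Theta> + 2) / ((\<Theta> - 1) * (\<Theta> + 2))"
  by (simp add: f1_def power2_eq_square algebra_simps)

text \<open>Absorbs the ratio 2 of the case in which the final batch is released only when the final
  schedule starts.\<close>

lemma f1_ge_2: "\<Theta> > 1 \<Longrightarrow> 2 \<le> f1 \<Theta>"
  using mult_pos_pos[of "\<Theta> - 1" "\<Theta> + 2"] by (simp add: f1_altdef le_divide_eq algebra_simps)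

text \<open>The bound for every offline schedule passes to the infimum afterwards. The cases are
  whether some request is pending while the server waits.\<close>

lemma smartstart_cost_le_sched_length:
  assumes \<Theta>: "\<Theta> > 1" and run: "smartstart_run c \<Theta> \<sigma> A" and "\<sigma> \<noteq> {}"
    and wait: "waits_before_final c \<sigma> A" and v: "valid_schedule c 0 0 \<sigma> S"
  shows "smartstart_cost c \<sigma> A \<le> f1 \<Theta> * sched_length 0 S"
proof -
  have N: "1 \<le> num A"
    using run \<open>\<sigma> \<noteq> {}\<close> by (cases "num A") (auto simp: smartstart_run_def)
  let ?T = "start A (num A)" and ?F = "finish c \<sigma> A (num A - 1)"
  let ?L = "L c ?T (pos A (num A)) (batch \<sigma> A (num A))"
  have FT: "?F < ?T" using wait by (simp add: waits_before_final_def)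
  show ?thesis
  proof (cases "\<exists>\<tau>. ?F \<le> \<tau> \<and> \<tau> < ?T \<and> pending \<sigma> A (num A) \<tau> \<noteq> {}")
    case True
    then have "?T \<le> ?L / (\<Theta> - 1)" using run_start_le_L[OF \<Theta> run N order_refl] by blast
    then have "smartstart_cost c \<sigma> A \<le> ?L / (\<Theta> - 1) + ?L" by (simp add: smartstart_cost_def)
    also have "\<dots> = \<Theta> / (\<Theta> - 1) * ?L" using \<Theta> by (simp add: field_simps)
    also have "\<dots> = \<Theta> / ((\<Theta> - 1) * (\<Theta> + 2)) * ((\<Theta> + 2) * ?L)" using \<Theta> by simp
    also have "\<dots> \<le> \<Theta> / ((\<Theta> - 1) * (\<Theta> + 2)) * ((2 * \<Theta> + 2) * sched_length 0 S)"
      using run_L_final_le[OF \<Theta> run N v] \<Theta> by (intro mult_left_mono) auto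
    also have "\<dots> = f1 \<Theta> * sched_length 0 S" by (simp add: f1_altdef)
    finally show ?thesis .
  next
    case False
    have "?T \<le> rel q" if q: "q \<in> batch \<sigma> A (num A)" for q
    proof (rule ccontr)
      assume "\<not> ?T \<le> rel q"
      \<comment> \<open>The first time at which the server is free and \<open>q\<close> is released;
        if it were below \<open>?T\<close>, the case assumption would fail.\<close>
      moreover have "q \<in> pending \<sigma> A (num A) (max ?F (rel q))"
        using q by (auto simp: batch_def pending_def)
      ultimately show False using False FT by (metis empty_iff max.cobounded1 max_less_iff_conj not_le)
    qed
    then have "smartstart_cost c \<sigma> A \<le> 2 * sched_length 0 S"
      using run_cost_le_fresh_batch[OF \<Theta> run N v] by blast
    also have "\<dots> \<le> f1 \<Theta> * sched_length 0 S"
      using f1_ge_2[OF \<Theta>] sched_length_nonneg[OF v] by (rule mult_right_mono)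
    finally show ?thesis .
  qed
qed

theorem proposition3p3:
  fixes \<Theta> :: real and c :: enat and \<sigma> :: "request set" and A :: run
  assumes "\<Theta> > 1"
    and "c \<ge> 1"
    and "dar_instance \<sigma>"
    and "smartstart_run c \<Theta> \<sigma> A"
    and "waits_before_final c \<sigma> A"
  shows "smartstart_cost c \<sigma> A \<le> f1 \<Theta> * Opt c \<sigma>"
proof -
  have fin: "finite \<sigma>" and ne: "\<sigma> \<noteq> {}" using assms(3) by (auto simp: dar_instance_def)
  have pos: "0 < f1 \<Theta>" using f1_ge_2[OF assms(1)] by simp
  \<comment> \<open>After division the claim is a lower bound for an infimum, to be checked on each
    schedule.\<close>
  have "smartstart_cost c \<sigma> A / f1 \<Theta> \<le> Opt c \<sigma>"
    unfolding Opt_def L_def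
  proof (rule cInf_greatest)
    show "{sched_length 0 S | S. valid_schedule c 0 0 \<sigma> S} \<noteq> {}"
      using valid_schedule_exists[OF fin assms(2)] by blast
  next
    fix l assume "l \<in> {sched_length 0 S | S. valid_schedule c 0 0 \<sigma> S}"
    then show "smartstart_cost c \<sigma> A / f1 \<Theta> \<le> l"
      using smartstart_cost_le_sched_length[OF assms(1,4) ne assms(5)] pos
      by (auto simp: divide_le_eq mult.commute)
  qed
  then show ?thesis using pos by (simp add: divide_le_eq mult.commute)
qed

end
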